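(* Let $\xi>0$, $v_{\max}>0$, $\bar v>0$, $\bar a>0$, $\gamma>0$, let $\kappa_{\rm sf}\ge \kappa>0$, let $D_{\rm st}>D_{\rm sf}$ be real numbers, and let $\Phi$ be a finite set of integers $k>1$. Let $A\ge 0$, $B_1\ge 0$, $B_k\ge 0$ for all $k\in\Phi$, and let $C_1\in\mathbb R$, $C_k\in\mathbb R$ for all $k\in\Phi$. Consider the connected automated vehicle dynamics with first-order lag $$\dot D_0 = v_1-v_0,\qquad \dot v_0=a_0,\qquad \dot a_0=\frac1\xi\,(u_0-a_0),\qquad \dot v_1=a_1,$$ with state $x=(D_0,v_0,a_0,v_1)$ and with the connected cruise controller $$u_0 = A\big(V(D_0)-v_0\big)+B_1\big(W(v_1)-v_0\big)+\sum_{k\in\Phi}B_k\big(W(v_k)-v_0\big)+C_1a_1+\sum_{k\in\Phi}C_ka_k,$$ where $V(D)=\min\{\kappa(D-D_{\rm st}),v_{\max}\}$ and $W(v)=\min\{v,v_{\max}\}$. Let $$h(x)=\kappa_{\rm sf}(D_0-D_{\rm sf})-v_0,\qquad h_{\rm e}(x)=\kappa_{\rm sf}(v_1-v_0)-a_0+\gamma\big(\kappa_{\rm sf}(D_0-D_{\rm sf})-v_0\big),$$ $$\mathcal S=\{x\in\mathbb R^4: h(x)\ge 0\},\qquad \mathcal S_{\rm e}=\{x\in\mathbb R^4: h_{\rm e}(x)\ge 0\}.$$ Suppose that $v_0\ge 0$, $|v_1-v_0|\le\bar v$, $|v_k-v_0|\le \bar v$ for all $k\in\Phi$, and $a_1,a_k\in[-\bar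 a,\bar a]$ for all $k\in\Phi$ (at all times along the motion), and that $$\frac{N_1\bar v+N_2\bar a}{\kappa(D_{\rm st}-D_{\rm sf})}\le A\le \frac{(1-\xi\kappa_{\rm sf})^2}{4\xi}-\xi\Big(\gamma-\frac{1-\xi\kappa_{\rm sf}}{2\xi}\Big)^2,$$ where $$N_1=|\kappa_{\rm sf}-\xi\kappa_{\rm sf}^2-B_1|+\sum_{k\in\Phi}B_k,\qquad N_2=|\xi\kappa_{\rm sf}-C_1|+\sum_{k\in\Phi}|C_k|.$$ Then the closed-loop system is safe with respect to $\mathcal S\cap\mathcal S_{\rm e}$.
   Context: Here $D_0$ is the distance between the controlled vehicle (index $0$) and the vehicle immediately ahead (index $1$); $v_0,a_0$ are the speed and acceleration of the controlled vehicle; $v_1$ is the speed of the vehicle immediately ahead and $a_1=\dot v_1$ its acceleration; $v_k$ and $a_k=\dot v_k$, $k\in\Phi$, are the speed and acceleration of the connected vehicle $k$ vehicles ahead. The signals $a_1(t)$ and $v_k(t),a_k(t)$, $k\in\Phi$, are exogenous (given) continuous functions of time. Safety: the closed-loop system is safe with respect to a set $\mathcal C\subset\mathbb R^4$ if every solution $x(t)$ (along which the stated bounds on $v_0$, $v_1-v_0$, $v_k-v_0$, $a_1$, $a_k$ hold) with $x(t_0)\in\mathcal C$ satisfies $x(t)\in\mathcal C$ for all $t\ge t_0$. *)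

theory Defs
  imports "HOL-Analysis.Analysis"
begin

lemma vector_4 [simp]:
  "(vector [w, x, y, z] :: ('a::zero)^4) $ 1 = w"
  "(vector [w, x, y, z] :: ('a::zero)^4) $ 2 = x"
  "(vector [w, x, y, z] :: ('a::zero)^4) $ 3 = y"
  "(vector [w, x, y, z] :: ('a::zero)^4) $ 4 = z"
  unfolding vector_def by simp_all

text \<open>The state is \<open>x = (D\<^sub>0, v\<^sub>0, a\<^sub>0, v\<^sub>1)\<close>.\<close>

abbreviation D0 :: "real^4 \<Rightarrow> real" where "D0 x \<equiv> x $ 1"
abbreviation v0 :: "real^4 \<Rightarrow> real" where "v0 x \<equiv> x $ 2"
abbreviation a0 :: "real^4 \<Rightarrow> real" where "a0 x \<equiv> x $ 3"
abbreviation v1 :: "real^4 \<Rightarrow> real" where "v1 x \<equiv> x $ 4"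

definition range_policy :: "real \<Rightarrow> real \<Rightarrow> real \<Rightarrow> real \<Rightarrow> real" where
  "range_policy \<kappa> Dst vmax D = min (\<kappa> * (D - Dst)) vmax"

definition speed_policy :: "real \<Rightarrow> real \<Rightarrow> real" where
  "speed_policy vmax v = min v vmax"

text \<open>
  The gains \<open>B\<close>, \<open>C\<close> and the exogenous signals \<open>a\<close>, \<open>v\<close> are indexed by the position of a
  vehicle ahead. Index \<open>1\<close> is the vehicle immediately ahead: \<open>a 1\<close> is its acceleration, whereas
  its speed is the state component \<open>v1\<close>, and \<open>v 1\<close> is never used.
\<close>

definition ccc_input ::
  "real \<Rightarrow> real \<Rightarrow> real \<Rightarrow> nat set \<Rightarrow> real \<Rightarrow> (nat \<Rightarrow> real) \<Rightarrow> (nat \<Rightarrow> real) \<Rightarrow>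
   (nat \<Rightarrow> real \<Rightarrow> real) \<Rightarrow> (nat \<Rightarrow> real \<Rightarrow> real) \<Rightarrow> real \<Rightarrow> real^4 \<Rightarrow> real" where
  "ccc_input \<kappa> Dst vmax \<Phi> A B C v a t x =
     A * (range_policy \<kappa> Dst vmax (D0 x) - v0 x)
     + B 1 * (speed_policy vmax (v1 x) - v0 x)
     + (\<Sum>k\<in>\<Phi>. B k * (speed_policy vmax (v k t) - v0 x))
     + C 1 * a 1 t
     + (\<Sum>k\<in>\<Phi>. C k * a k t)"

definition lag_vehicle_field ::
  "real \<Rightarrow> (real \<Rightarrow> real) \<Rightarrow> (real \<Rightarrow> real^4 \<Rightarrow> real) \<Rightarrow> real \<Rightarrow> real^4 \<Rightarrow> real^4" where
  "lag_vehicle_field \<xi> a1 u0 t x =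
     vector [v1 x - v0 x, a0 x, (1 / \<xi>) * (u0 t x - a0 x), a1 t]"

definition ode_solution_on ::
  "(real \<Rightarrow> real^4 \<Rightarrow> real^4) \<Rightarrow> real set \<Rightarrow> (real \<Rightarrow> real^4) \<Rightarrow> bool" where
  "ode_solution_on F I x \<longleftrightarrow> (\<forall>t\<in>I. (x has_vector_derivative F t (x t)) (at t within I))"

definition motion_bounds ::
  "real \<Rightarrow> real \<Rightarrow> nat set \<Rightarrow> (nat \<Rightarrow> real \<Rightarrow> real) \<Rightarrow> (nat \<Rightarrow> real \<Rightarrow> real) \<Rightarrow>
   real \<Rightarrow> real^4 \<Rightarrow> bool" where
  "motion_bounds vbar abar \<Phi> v a t x \<longleftrightarrow>
     0 \<le> v0 x \<and> \<bar>v1 x - v0 x\<bar> \<le> vbar \<and> (\<forall>k\<in>\<Phi>. \<bar>v k t - v0 x\<bar> \<le> vbar) \<and>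
     a 1 t \<in> {-abar..abar} \<and> (\<forall>k\<in>\<Phi>. a k t \<in> {-abar..abar})"

text \<open>
  Solutions are considered on arbitrary time intervals containing the initial time; taking
  \<open>I = {t0..}\<close> gives the solutions defined for all future times. The predicate \<open>P\<close> expresses
  the bounds that are stipulated along the motion.
\<close>

definition safe_wrt ::
  "(real \<Rightarrow> real^4 \<Rightarrow> real^4) \<Rightarrow> (real \<Rightarrow> real^4 \<Rightarrow> bool) \<Rightarrow> (real^4) set \<Rightarrow> bool" where
  "safe_wrt F P K \<longleftrightarrow>
     (\<forall>I x t0. is_interval I \<longrightarrow> t0 \<in> I \<longrightarrow> ode_solution_on F I x \<longrightarrow> (\<forall>t\<in>I. P t (x t)) \<longrightarrow>
        x t0 \<in> K \<longrightarrow> (\<forall>t\<in>I. t0 \<le> t \<longrightarrow> x t \<in> K))"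

definition h_fun :: "real \<Rightarrow> real \<Rightarrow> real^4 \<Rightarrow> real" where
  "h_fun \<kappa>sf Dsf x = \<kappa>sf * (D0 x - Dsf) - v0 x"

definition he_fun :: "real \<Rightarrow> real \<Rightarrow> real \<Rightarrow> real^4 \<Rightarrow> real" where
  "he_fun \<kappa>sf Dsf \<gamma> x =
     \<kappa>sf * (v1 x - v0 x) - a0 x + \<gamma> * (\<kappa>sf * (D0 x - Dsf) - v0 x)"

definition S_set :: "real \<Rightarrow> real \<Rightarrow> (real^4) set" where
  "S_set \<kappa>sf Dsf = {x. h_fun \<kappa>sf Dsf x \<ge> 0}"

definition Se_set :: "real \<Rightarrow> real \<Rightarrow> real \<Rightarrow> (real^4) set" where
  "Se_set \<kappa>sf Dsf \<gamma> = {x. he_fun \<kappa>sf Dsf \<gamma> x \<ge> 0}"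

definition N1 :: "real \<Rightarrow> real \<Rightarrow> nat set \<Rightarrow> (nat \<Rightarrow> real) \<Rightarrow> real" where
  "N1 \<xi> \<kappa>sf \<Phi> B = \<bar>\<kappa>sf - \<xi> * \<kappa>sf\<^sup>2 - B 1\<bar> + (\<Sum>k\<in>\<Phi>. B k)"

definition N2 :: "real \<Rightarrow> real \<Rightarrow> nat set \<Rightarrow> (nat \<Rightarrow> real) \<Rightarrow> real" where
  "N2 \<xi> \<kappa>sf \<Phi> C = \<bar>\<xi> * \<kappa>sf - C 1\<bar> + (\<Sum>k\<in>\<Phi>. \<bar>C k\<bar>)"

end

theory Submission
  imports Defs
begin

text \<open>
  Along the motion \<open>h' = he - \<gamma> * h\<close>. Eliminating the acceleration of the controlled vehicle in
  favour of \<open>h\<close> and \<open>he\<close>, the bounds on \<open>A\<close> give \<open>\<xi> * he' \<ge> c * he + L * h\<close> with a constant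
  \<open>L \<ge> 0\<close>, whatever the sign of \<open>h\<close>. The linear comparison system is cooperative, so it preserves
  the positive quadrant. To see this with scalar comparisons only, take \<open>s \<ge> 0\<close> such that
  \<open>(s, 1)\<close> is a left eigenvector of the system: then \<open>he + s * h\<close> stays nonnegative, hence so does
  \<open>h\<close>, and finally so does \<open>he\<close>.
\<close>

text \<open>With the integrating factor \<open>exp (- k * t)\<close> the product
  \<open>exp (- k * t) * f t\<close> has nonnegative derivative, so by the mean value theorem it
  cannot drop below its initial value. The sign of \<open>k\<close> is arbitrary.\<close>

lemma nonneg_if_derivative_ge_linear:
  fixes f f' :: "real \<Rightarrow> real" and k :: real
  assumes "s \<le> T"
    and deriv: "\<And>t. t \<in> {s..T} \<Longrightarrow> (f has_real_derivative f' t) (at t within {s..T})"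
    and ge: "\<And>t. t \<in> {s..T} \<Longrightarrow> f' t \<ge> k * f t"
    and "f s \<ge> 0"
  shows "f T \<ge> 0"
proof (cases "s = T")
  case True
  then show ?thesis using assms by simp
next
  case False
  let ?g = "\<lambda>t. exp (- k * t) * f t"
  have "(?g has_derivative (*) (exp (- k * t) * (f' t - k * f t))) (at t within {s..T})"
    if "t \<in> {s..T}" for t
    unfolding has_field_derivative_def[symmetric]
    by (rule derivative_eq_intros deriv[OF that] refl | simp add: algebra_simps)+
  then obtain z where z: "z \<in> {s<..<T}"
    and eq: "?g T - ?g s = exp (- k * z) * (f' z - k * f z) * (T - s)"
    using mvt_simple[of s T ?g "\<lambda>t. (*) (exp (- k * t) * (f' t - k * f t))"] assms(1) False
    by auto
  have "0 \<le> exp (- k * z) * (f' z - k * f z) * (T - s)"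
    using ge[of z] z by auto
  then have "?g s \<le> ?g T" using eq by linarith
  moreover have "0 \<le> ?g s" using assms(4) by simp
  ultimately have "0 \<le> ?g T" by linarith
  then show ?thesis by (simp add: zero_le_mult_iff)
qed

lemma cooperative_system_nonneg:
  fixes f g f' g' :: "real \<Rightarrow> real" and p q r l :: real
  assumes df: "\<And>t. t \<in> {t0..T} \<Longrightarrow> (f has_real_derivative f' t) (at t within {t0..T})"
    and dg: "\<And>t. t \<in> {t0..T} \<Longrightarrow> (g has_real_derivative g' t) (at t within {t0..T})"
    and f': "\<And>t. t \<in> {t0..T} \<Longrightarrow> f' t \<ge> g t - q * f t"
    and g': "\<And>t. t \<in> {t0..T} \<Longrightarrow> g' t \<ge> p * g t + l * f t"
    and "l \<ge> 0" "f t0 \<ge> 0" "g t0 \<ge> 0" and t: "t \<in> {t0..T}"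
  shows "f t \<ge> 0" "g t \<ge> 0"
proof -
  \<comment> \<open>The nonnegative root of \<open>s * s + (p + q) * s = l\<close>. This equation
    says that \<open>(s, 1)\<close> is a left eigenvector, with eigenvalue \<open>p + s\<close>, of
    the matrix with rows \<open>(-q, 1)\<close> and \<open>(l, p)\<close>.\<close>
  define s where "s = (sqrt ((p + q)\<^sup>2 + 4 * l) - (p + q)) / 2"
  have "\<bar>p + q\<bar> \<le> sqrt ((p + q)\<^sup>2 + 4 * l)"
    using \<open>l \<ge> 0\<close> by (intro real_le_rsqrt) simp
  then have s0: "s \<ge> 0" unfolding s_def by simp
  have "(2 * s + (p + q))\<^sup>2 = (p + q)\<^sup>2 + 4 * l"
    unfolding s_def using \<open>l \<ge> 0\<close> by (simp add: add_divide_distrib diff_divide_distrib)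
  then have s_root: "l = s * s + (p + q) * s"
    by (simp add: power2_eq_square algebra_simps)
  \<comment> \<open>The scalar comparison concludes at the right endpoint only, so it is run on
    \<open>{t0..u}\<close> for each \<open>u\<close> separately.\<close>
  have sub: "{t0..u} \<subseteq> {t0..T}" if "u \<in> {t0..T}" for u using that by auto
  note df' = DERIV_subset[OF df sub]
  note dg' = DERIV_subset[OF dg sub]
  have w: "g u + s * f u \<ge> 0" if u: "u \<in> {t0..T}" for u
  proof (rule nonneg_if_derivative_ge_linear[where k = "p + s" and s = t0 and T = u
        and f = "\<lambda>t. g t + s * f t"])
    show "t0 \<le> u" using u by simp
    show "((\<lambda>t. g t + s * f t) has_real_derivative (g' t + s * f' t)) (at t within {t0..u})"
      if "t \<in> {t0..u}" for t
      using that u by (auto intro!: derivative_eq_intros df' dg')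
    show "(p + s) * (g t + s * f t) \<le> g' t + s * f' t" if "t \<in> {t0..u}" for t
    proof -
      have "t \<in> {t0..T}" using that u by auto
      then have "s * (g t - q * f t) \<le> s * f' t" "p * g t + l * f t \<le> g' t"
        using f' g' s0 by (simp_all add: mult_left_mono)
      then show ?thesis unfolding s_root by (simp add: algebra_simps)
    qed
    show "0 \<le> g t0 + s * f t0" using assms s0 by simp
  qed
  \<comment> \<open>The previous bound gives \<open>g \<ge> - s * f\<close>, which turns the
    inequality for \<open>f'\<close> into a scalar one.\<close>
  have f: "f u \<ge> 0" if u: "u \<in> {t0..T}" for u
  proof (rule nonneg_if_derivative_ge_linear[where k = "- (s + q)" and s = t0 and T = u])
    show "t0 \<le> u" using u by simp
    show "(f has_real_derivative f' t) (at t within {t0..u})" if "t \<in> {t0..u}" for t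
      using that u by (auto intro!: df')
    show "- (s + q) * f t \<le> f' t" if "t \<in> {t0..u}" for t
      using w[of t] f'[of t] that u by (simp add: algebra_simps)
    show "0 \<le> f t0" by fact
  qed
  show "f t \<ge> 0" using f t .
  show "g t \<ge> 0"
  proof (rule nonneg_if_derivative_ge_linear[where k = p and s = t0 and T = t])
    show "t0 \<le> t" using t by simp
    show "(g has_real_derivative g' u) (at u within {t0..t})" if "u \<in> {t0..t}" for u
      using that t by (auto intro!: dg')
    show "p * g u \<le> g' u" if "u \<in> {t0..t}" for u
    proof -
      have "0 \<le> l * f u" using f[of u] that t \<open>l \<ge> 0\<close> by simp
      then show ?thesis using g'[of u] that t by simp
    qed
    show "0 \<le> g t0" by fact
  qed
qed

text \<open>Saturation at \<open>vmax\<close> only lowers the input because the gains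
  \<open>A\<close> and \<open>B\<close> are nonnegative, so each minimum can be replaced by its
  unsaturated argument. The terms in \<open>v1\<close> and \<open>a 1\<close> are kept exact, since
  they later combine with like terms in the rate of \<open>he_fun\<close>; those of the vehicles in
  \<Phi> are bounded at once.\<close>

lemma ccc_input_le:
  assumes "A \<ge> 0" "B 1 \<ge> 0" "\<forall>k\<in>\<Phi>. B k \<ge> 0"
    and mb: "motion_bounds vbar abar \<Phi> v a t x"
  shows "ccc_input \<kappa> Dst vmax \<Phi> A B C v a t x \<le>
     A * (\<kappa> * (D0 x - Dst) - v0 x) + B 1 * (v1 x - v0 x) + C 1 * a 1 t
     + (\<Sum>k\<in>\<Phi>. B k) * vbar + (\<Sum>k\<in>\<Phi>. \<bar>C k\<bar>) * abar"
proof -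
  have "A * (range_policy \<kappa> Dst vmax (D0 x) - v0 x) \<le> A * (\<kappa> * (D0 x - Dst) - v0 x)"
    using assms(1) by (intro mult_left_mono) (auto simp: range_policy_def)
  moreover have "B 1 * (speed_policy vmax (v1 x) - v0 x) \<le> B 1 * (v1 x - v0 x)"
    using assms(2) by (intro mult_left_mono) (auto simp: speed_policy_def)
  moreover have "(\<Sum>k\<in>\<Phi>. B k * (speed_policy vmax (v k t) - v0 x)) \<le> (\<Sum>k\<in>\<Phi>. B k * vbar)"
  proof (intro sum_mono mult_left_mono)
    fix k assume "k \<in> \<Phi>"
    then have "\<bar>v k t - v0 x\<bar> \<le> vbar" using mb by (auto simp: motion_bounds_def)
    then show "speed_policy vmax (v k t) - v0 x \<le> vbar" by (auto simp: speed_policy_def)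
  qed (use assms(3) in auto)
  moreover have "(\<Sum>k\<in>\<Phi>. C k * a k t) \<le> (\<Sum>k\<in>\<Phi>. \<bar>C k\<bar> * abar)"
  proof (intro sum_mono)
    fix k assume "k \<in> \<Phi>"
    then have "\<bar>a k t\<bar> \<le> abar" using mb by (auto simp: motion_bounds_def abs_le_iff)
    then have "\<bar>C k\<bar> * \<bar>a k t\<bar> \<le> \<bar>C k\<bar> * abar" by (simp add: mult_left_mono)
    then show "C k * a k t \<le> \<bar>C k\<bar> * abar" unfolding abs_mult[symmetric] by linarith
  qed
  ultimately show ?thesis
    by (simp add: ccc_input_def sum_distrib_right)
qed

text \<open>Undoes the completed square in the upper bound on \<open>A\<close>; used with
  \<open>b = 1 - \<xi> * \<kappa>sf\<close>.\<close>

lemma gain_condition_expand: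
  fixes \<xi> b \<gamma> :: real
  assumes "\<xi> > 0"
  shows "b\<^sup>2 / (4 * \<xi>) - \<xi> * (\<gamma> - b / (2 * \<xi>))\<^sup>2 = \<gamma> * b - \<xi> * \<gamma>\<^sup>2"
  using assms by (simp add: field_simps power2_eq_square)

text \<open>The left side of the conclusion is the derivative of \<open>he_fun\<close> along the
  motion. The estimate holds because the offset \<open>Dst - Dsf\<close>, weighted by
  \<open>A * \<kappa>\<close>, outweighs the worst case of all terms in relative speeds and
  accelerations.\<close>

lemma he_rate_ge:
  fixes \<xi> vmax vbar abar \<gamma> \<kappa>sf \<kappa> Dst Dsf A t :: real and x :: "real^4"
  defines "E \<equiv> \<gamma> * (1 - \<xi> * \<kappa>sf) - \<xi> * \<gamma>\<^sup>2"
  assumes "\<xi> > 0" "\<kappa>sf \<ge> \<kappa>" "\<kappa> > 0" "Dst > Dsf"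
    and "A \<ge> 0" "B 1 \<ge> 0" "\<forall>k\<in>\<Phi>. B k \<ge> 0"
    and lower: "(N1 \<xi> \<kappa>sf \<Phi> B * vbar + N2 \<xi> \<kappa>sf \<Phi> C * abar) / (\<kappa> * (Dst - Dsf)) \<le> A"
    and mb: "motion_bounds vbar abar \<Phi> v a t x"
  defines "u \<equiv> ccc_input \<kappa> Dst vmax \<Phi> A B C v a t x"
  shows "\<kappa>sf * (a 1 t - a0 x) - (u - a0 x) / \<xi> + \<gamma> * (\<kappa>sf * (v1 x - v0 x) - a0 x)
     \<ge> (\<gamma> - 1 / \<xi> + \<kappa>sf) * he_fun \<kappa>sf Dsf \<gamma> x
        + (E - A * \<kappa> / \<kappa>sf) / \<xi> * h_fun \<kappa>sf Dsf x"
proof -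
  define h where "h = h_fun \<kappa>sf Dsf x"
  define he where "he = he_fun \<kappa>sf Dsf \<gamma> x"
  have \<kappa>sf: "\<kappa>sf > 0" using assms by linarith
  have a0: "a0 x = \<kappa>sf * (v1 x - v0 x) + \<gamma> * h - he"
    by (simp add: h_def he_def h_fun_def he_fun_def)
  have a1: "\<bar>a 1 t\<bar> \<le> abar" and rel: "\<bar>v1 x - v0 x\<bar> \<le> vbar" and v0: "0 \<le> v0 x"
    using mb by (auto simp: motion_bounds_def abs_le_iff)
  have "\<bar>\<xi> * \<kappa>sf - C 1\<bar> * \<bar>a 1 t\<bar> \<le> \<bar>\<xi> * \<kappa>sf - C 1\<bar> * abar"
    using a1 by (simp add: mult_left_mono)
  then have 1: "(\<xi> * \<kappa>sf - C 1) * a 1 t \<ge> - (\<bar>\<xi> * \<kappa>sf - C 1\<bar> * abar)"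
    unfolding abs_mult[symmetric] by linarith
  have "\<bar>\<kappa>sf - \<xi> * \<kappa>sf\<^sup>2 - B 1\<bar> * \<bar>v1 x - v0 x\<bar> \<le> \<bar>\<kappa>sf - \<xi> * \<kappa>sf\<^sup>2 - B 1\<bar> * vbar"
    using rel by (simp add: mult_left_mono)
  then have 2: "(\<kappa>sf - \<xi> * \<kappa>sf\<^sup>2 - B 1) * (v1 x - v0 x) \<ge> - (\<bar>\<kappa>sf - \<xi> * \<kappa>sf\<^sup>2 - B 1\<bar> * vbar)"
    unfolding abs_mult[symmetric] by linarith
  have "N1 \<xi> \<kappa>sf \<Phi> B * vbar + N2 \<xi> \<kappa>sf \<Phi> C * abar \<le> A * \<kappa> * (Dst - Dsf)"
    using lower assms(4,5) by (simp add: pos_divide_le_eq mult.assoc)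
  then have 3: "\<bar>\<kappa>sf - \<xi> * \<kappa>sf\<^sup>2 - B 1\<bar> * vbar + (\<Sum>k\<in>\<Phi>. B k) * vbar
      + \<bar>\<xi> * \<kappa>sf - C 1\<bar> * abar + (\<Sum>k\<in>\<Phi>. \<bar>C k\<bar>) * abar \<le> A * \<kappa> * (Dst - Dsf)"
    by (simp add: N1_def N2_def distrib_right)
  have u: "u \<le> A * (\<kappa> * (D0 x - Dst) - v0 x) + B 1 * (v1 x - v0 x) + C 1 * a 1 t
     + (\<Sum>k\<in>\<Phi>. B k) * vbar + (\<Sum>k\<in>\<Phi>. \<bar>C k\<bar>) * abar"
    unfolding u_def by (rule ccc_input_le[OF assms(6-8) mb])
  \<comment> \<open>Trading distance for \<open>h\<close> leaves a multiple of \<open>v0 x\<close>.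
    As \<open>\<kappa> \<le> \<kappa>sf\<close> and \<open>v0 x \<ge> 0\<close>, it is dominated by
    the term \<open>A * v0 x\<close> of the controller.\<close>
  have "D0 x - Dsf = (h + v0 x) / \<kappa>sf"
    using \<kappa>sf by (simp add: h_def h_fun_def field_simps)
  then have "A * \<kappa> * (D0 x - Dsf) = A * \<kappa> / \<kappa>sf * h + A * \<kappa> / \<kappa>sf * v0 x"
    by (simp add: algebra_simps add_divide_distrib)
  moreover have "A * \<kappa> / \<kappa>sf * v0 x \<le> A * v0 x"
  proof (rule mult_right_mono)
    show "A * \<kappa> / \<kappa>sf \<le> A"
      using \<kappa>sf assms(3,6) by (simp add: pos_divide_le_eq mult_left_mono)
  qed (rule v0)
  ultimately have 4: "A * \<kappa> * (D0 x - Dsf) \<le> A * \<kappa> / \<kappa>sf * h + A * v0 x" by linarith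
  have 5: "A * (\<kappa> * (D0 x - Dst) - v0 x) =
      A * \<kappa> * (D0 x - Dsf) - A * \<kappa> * (Dst - Dsf) - A * v0 x"
    by (simp add: algebra_simps)
  \<comment> \<open>After \<open>a0\<close> is substituted, \<gamma> cancels from the coefficient of
    \<open>v1 x - v0 x\<close>, and \<open>E\<close> is what remains in front of
    \<open>h\<close>.\<close>
  have "\<xi> * (\<kappa>sf * (a 1 t - a0 x) - (u - a0 x) / \<xi> + \<gamma> * (\<kappa>sf * (v1 x - v0 x) - a0 x))
      = \<xi> * \<kappa>sf * a 1 t + (\<kappa>sf - \<xi> * \<kappa>sf\<^sup>2) * (v1 x - v0 x) + E * h
        + (\<xi> * \<gamma> - 1 + \<xi> * \<kappa>sf) * he - u"
    using assms(2) unfolding a0 E_def by (simp add: field_simps power2_eq_square)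
  \<comment> \<open>Subtracting the bound on \<open>u\<close> leaves the coefficients whose absolute
    values enter \<open>N1\<close> and \<open>N2\<close>. Expanding the differences lets linear
    arithmetic treat the remaining products as atoms.\<close>
  also have "\<dots> \<ge> (\<xi> * \<gamma> - 1 + \<xi> * \<kappa>sf) * he + (E - A * \<kappa> / \<kappa>sf) * h"
    using u 1 2 3 4 5
    unfolding left_diff_distrib[of "\<xi> * \<kappa>sf" "C 1"]
      left_diff_distrib[of "\<kappa>sf - \<xi> * \<kappa>sf\<^sup>2" "B 1"] left_diff_distrib[of E]
    by linarith
  also have "(\<xi> * \<gamma> - 1 + \<xi> * \<kappa>sf) * he + (E - A * \<kappa> / \<kappa>sf) * h
      = \<xi> * ((\<gamma> - 1 / \<xi> + \<kappa>sf) * he + (E - A * \<kappa> / \<kappa>sf) / \<xi> * h)"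
    using assms(2) \<kappa>sf by (simp add: field_simps)
  finally have "\<xi> * ((\<gamma> - 1 / \<xi> + \<kappa>sf) * he + (E - A * \<kappa> / \<kappa>sf) / \<xi> * h)
      \<le> \<xi> * (\<kappa>sf * (a 1 t - a0 x) - (u - a0 x) / \<xi> + \<gamma> * (\<kappa>sf * (v1 x - v0 x) - a0 x))" .
  then show ?thesis
    using assms(2) unfolding h_def he_def by simp
qed

theorem theorem4:
  fixes \<xi> vmax vbar abar \<gamma> \<kappa>sf \<kappa> Dst Dsf A :: real
    and \<Phi> :: "nat set"
    and B C :: "nat \<Rightarrow> real"
    and v a :: "nat \<Rightarrow> real \<Rightarrow> real"
  assumes "\<xi> > 0" and "vmax > 0" and "vbar > 0" and "abar > 0" and "\<gamma> > 0"
    and "\<kappa>sf \<ge> \<kappa>" and "\<kappa> > 0" and "Dst > Dsf"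
    and "finite \<Phi>" and "\<forall>k\<in>\<Phi>. k > 1"
    and "A \<ge> 0" and "B 1 \<ge> 0" and "\<forall>k\<in>\<Phi>. B k \<ge> 0"
    and "continuous_on UNIV (a 1)"
    and "\<forall>k\<in>\<Phi>. continuous_on UNIV (v k) \<and> continuous_on UNIV (a k)"
    and "\<forall>k\<in>\<Phi>. \<forall>t. (v k has_real_derivative a k t) (at t)"
    and "(N1 \<xi> \<kappa>sf \<Phi> B * vbar + N2 \<xi> \<kappa>sf \<Phi> C * abar) / (\<kappa> * (Dst - Dsf)) \<le> A"
    and "A \<le> (1 - \<xi> * \<kappa>sf)\<^sup>2 / (4 * \<xi>) - \<xi> * (\<gamma> - (1 - \<xi> * \<kappa>sf) / (2 * \<xi>))\<^sup>2"
  shows "safe_wrt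
           (lag_vehicle_field \<xi> (a 1) (ccc_input \<kappa> Dst vmax \<Phi> A B C v a))
           (motion_bounds vbar abar \<Phi> v a)
           (S_set \<kappa>sf Dsf \<inter> Se_set \<kappa>sf Dsf \<gamma>)"
proof -
  define u where "u = ccc_input \<kappa> Dst vmax \<Phi> A B C v a"
  define E where "E = \<gamma> * (1 - \<xi> * \<kappa>sf) - \<xi> * \<gamma>\<^sup>2"
  \<comment> \<open>The upper bound on \<open>A\<close> serves to make the coefficient of
    \<open>h_fun\<close> nonnegative, as a cooperative system requires.\<close>
  have "A \<le> E"
    using assms(18) unfolding gain_condition_expand[OF assms(1)] E_def .
  moreover have "A * \<kappa> / \<kappa>sf \<le> A"
    using assms(6,7,11) by (simp add: pos_divide_le_eq mult_left_mono)
  ultimately have l: "0 \<le> (E - A * \<kappa> / \<kappa>sf) / \<xi>"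
    using assms(1) by simp
  have main: "x t \<in> S_set \<kappa>sf Dsf \<inter> Se_set \<kappa>sf Dsf \<gamma>"
    if I: "is_interval I" "t0 \<in> I" and sol: "ode_solution_on (lag_vehicle_field \<xi> (a 1) u) I x"
      and mb: "\<forall>t\<in>I. motion_bounds vbar abar \<Phi> v a t (x t)"
      and x0: "x t0 \<in> S_set \<kappa>sf Dsf \<inter> Se_set \<kappa>sf Dsf \<gamma>" and t: "t \<in> I" "t0 \<le> t"
    for I x t0 t
  proof -
    have sub: "{t0..t} \<subseteq> I"
      using mem_is_interval_1_I[OF I t(1)] by auto
    have comp: "((\<lambda>r. x r $ i) has_real_derivative lag_vehicle_field \<xi> (a 1) u r (x r) $ i)
        (at r within {t0..t})" if "r \<in> {t0..t}" for r i
    proof -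
      have "(x has_vector_derivative lag_vehicle_field \<xi> (a 1) u r (x r)) (at r within {t0..t})"
        using sol sub that unfolding ode_solution_on_def
        by (meson has_vector_derivative_within_subset subsetD)
      then show ?thesis
        unfolding has_real_derivative_iff_has_vector_derivative
        by (rule bounded_linear.has_vector_derivative[OF bounded_linear_vec_nth])
    qed
    note comps = comp[of _ 1, unfolded lag_vehicle_field_def vector_4]
      comp[of _ 2, unfolded lag_vehicle_field_def vector_4]
      comp[of _ 3, unfolded lag_vehicle_field_def vector_4]
      comp[of _ 4, unfolded lag_vehicle_field_def vector_4]
    let ?h = "\<lambda>r. h_fun \<kappa>sf Dsf (x r)" and ?he = "\<lambda>r. he_fun \<kappa>sf Dsf \<gamma> (x r)"
    let ?h' = "\<lambda>r. \<kappa>sf * (v1 (x r) - v0 (x r)) - a0 (x r)"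
    let ?he' = "\<lambda>r. \<kappa>sf * (a 1 r - a0 (x r)) - (u r (x r) - a0 (x r)) / \<xi> + \<gamma> * ?h' r"
    have dh: "(?h has_real_derivative ?h' r) (at r within {t0..t})" if "r \<in> {t0..t}" for r
      unfolding h_fun_def using that by (auto intro!: derivative_eq_intros comps)
    have dhe: "(?he has_real_derivative ?he' r) (at r within {t0..t})" if "r \<in> {t0..t}" for r
      unfolding he_fun_def using that by (auto intro!: derivative_eq_intros comps)
    \<comment> \<open>In fact an equality: \<open>he_fun\<close> is the derivative of
      \<open>h_fun\<close> along the motion plus \<open>\<gamma> * h_fun\<close>.\<close>
    have h': "?h' r \<ge> ?he r - \<gamma> * ?h r" for r
      by (simp add: h_fun_def he_fun_def)
    have he': "?he' r \<ge> (\<gamma> - 1 / \<xi> + \<kappa>sf) * ?he r + (E - A * \<kappa> / \<kappa>sf) / \<xi> * ?h r"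
      if "r \<in> {t0..t}" for r
      unfolding u_def E_def
      by (rule he_rate_ge) (use assms mb sub that in auto)
    have "?h t0 \<ge> 0" "?he t0 \<ge> 0" "t \<in> {t0..t}"
      using x0 t by (auto simp: S_set_def Se_set_def)
    from cooperative_system_nonneg[where f = ?h and g = ?he, OF dh dhe h' he' l this]
    show ?thesis by (simp add: S_set_def Se_set_def)
  qed
  show ?thesis
    unfolding safe_wrt_def u_def[symmetric] using main by blast
qed

end
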